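(* Let $\lambda_1,\dots,\lambda_n>0$, $\mu_1>\cdots>\mu_n>0$ and $\alpha\in[\tfrac12,1]$ be given, and let the service times be exponential, i.e. $v_i=2/\mu_i^2$ for all $i$. For any optimal solution $\boldsymbol x^*$ of the queue assignment problem $$(\mathrm{QAP})\qquad \inf_{\boldsymbol x}\ f(\boldsymbol x,\alpha)\quad\text{s.t. }\boldsymbol x\in\mathcal F_\alpha,\ x_i\in[0,1],\ i=1,\dots,n,$$ there exist integers $0\le l<h\le n$ such that: (i) $x_i^*=1$ whenever $i>h$ or $i<l$; (ii) $x_i^*=0$ whenever $l<i<h$; (iii) $x_i^*\in[0,1]$ for $i\in\{l,h\}$; moreover, the set $\mathcal M^*=\{i:0<x_i^*<1\}$ is either empty or a singleton. (Here $i$ ranges over $\{1,\dots,n\}$.)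
   Context: There are $n$ customer types; type $i$ arrives as a Poisson process with rate $\lambda_i$ and has an exponential service time with rate $\mu_i$ under a unit-capacity server. Unit capacity is split into two queues with capacities $\alpha$ and $1-\alpha$; $x_i$ is the probability that a type $i$ customer is assigned to the first queue. The expected waiting time is, for $0<\alpha<1$, $$f(\boldsymbol x,\alpha)=\frac{\sum_i\frac{\lambda_ix_i}{\mu_i^2}}{\alpha^2-\alpha\sum_i\frac{\lambda_ix_i}{\mu_i}}\cdot\frac{\sum_ix_i\lambda_i}{\sum_i\lambda_i}+\frac{\sum_i\frac{\lambda_i(1-x_i)}{\mu_i^2}}{(1-\alpha)^2-(1-\alpha)\sum_i\frac{\lambda_i(1-x_i)}{\mu_i}}\cdot\frac{\sum_i(1-x_i)\lambda_i}{\sum_i\lambda_i},$$ and $f(\boldsymbol 0,0)=f(\boldsymbol 1,1)=\left(\sum_i\lambda_i/\mu_i^2\right)/\left(1-\sum_i\lambda_i/\mu_i\right)$. The feasible sets are $\mathcal F_\alpha=\{\boldsymbol x:\sum_i\frac{\lambda_ix_i}{\mu_i}<\alpha<\sum_i\frac{\lambda_ix_i}{\mu_i}+1-\sum_i\frac{\lambda_i}{\mu_i}\}$ for $0<\alpha<1$, and $\mathcal F_0=\{\boldsymbol 0\}$, $\mathcal F_1=\{\boldsymbol 1\}$. *)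

theory Defs
  imports Complex_Main
begin

text \<open>
  Vectors indexed by the customer types are functions \<open>nat \<Rightarrow> real\<close>, of which only the
  components in \<open>{1..n}\<close> are ever consulted.
\<close>

text \<open>
  Pollaczek--Khinchine waiting time for exponential service times: the second moment of the
  service time of type \<open>i\<close> under unit capacity is \<open>2 / (mu i)\<^sup>2\<close>, and the factor 2 cancels.
  For \<open>\<alpha> = 0\<close> and \<open>\<alpha> = 1\<close> there is a single queue; the value given by the last branch is
  meaningful only at the unique feasible assignment (all zeros and all ones, respectively).
\<close>

definition waiting_time ::
  "nat \<Rightarrow> (nat \<Rightarrow> real) \<Rightarrow> (nat \<Rightarrow> real) \<Rightarrow> (nat \<Rightarrow> real) \<Rightarrow> real \<Rightarrow> real" where
  "waiting_time n lam mu x \<alpha> =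
    (if 0 < \<alpha> \<and> \<alpha> < 1 then
       (\<Sum>i=1..n. lam i * x i / (mu i)\<^sup>2) / (\<alpha>\<^sup>2 - \<alpha> * (\<Sum>i=1..n. lam i * x i / mu i))
         * ((\<Sum>i=1..n. x i * lam i) / (\<Sum>i=1..n. lam i))
     + (\<Sum>i=1..n. lam i * (1 - x i) / (mu i)\<^sup>2)
         / ((1 - \<alpha>)\<^sup>2 - (1 - \<alpha>) * (\<Sum>i=1..n. lam i * (1 - x i) / mu i))
         * ((\<Sum>i=1..n. (1 - x i) * lam i) / (\<Sum>i=1..n. lam i))
     else (\<Sum>i=1..n. lam i / (mu i)\<^sup>2) / (1 - (\<Sum>i=1..n. lam i / mu i)))"

definition stable_set ::
  "nat \<Rightarrow> (nat \<Rightarrow> real) \<Rightarrow> (nat \<Rightarrow> real) \<Rightarrow> real \<Rightarrow> (nat \<Rightarrow> real) set" where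
  "stable_set n lam mu \<alpha> =
    (if \<alpha> = 0 then {x. \<forall>i\<in>{1..n}. x i = 0}
     else if \<alpha> = 1 then {x. \<forall>i\<in>{1..n}. x i = 1}
     else {x. (\<Sum>i=1..n. lam i * x i / mu i) < \<alpha> \<and>
              \<alpha> < (\<Sum>i=1..n. lam i * x i / mu i) + 1 - (\<Sum>i=1..n. lam i / mu i)})"

definition qap_feasible ::
  "nat \<Rightarrow> (nat \<Rightarrow> real) \<Rightarrow> (nat \<Rightarrow> real) \<Rightarrow> real \<Rightarrow> (nat \<Rightarrow> real) set" where
  "qap_feasible n lam mu \<alpha> = stable_set n lam mu \<alpha> \<inter> {x. \<forall>i\<in>{1..n}. x i \<in> {0..1}}"

definition qap_optimal ::
  "nat \<Rightarrow> (nat \<Rightarrow> real) \<Rightarrow> (nat \<Rightarrow> real) \<Rightarrow> real \<Rightarrow> (nat \<Rightarrow> real) \<Rightarrow> bool" where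
  "qap_optimal n lam mu \<alpha> x \<longleftrightarrow>
     x \<in> qap_feasible n lam mu \<alpha> \<and>
     (\<forall>y\<in>qap_feasible n lam mu \<alpha>. waiting_time n lam mu x \<alpha> \<le> waiting_time n lam mu y \<alpha>)"

end

theory Submission
  imports Defs
begin

text \<open>
  Write \<open>t = 1 / mu\<close>. The cost depends on the assignment only through the three moments
  \<open>\<Sum>lam x t\<^sup>k\<close>, \<open>k = 0, 1, 2\<close>, so the derivative in the direction of type \<open>i\<close> is a quadratic \<open>q\<close>
  evaluated at \<open>t i\<close>, and optimality gives \<open>q (t i) \<ge> 0\<close> if \<open>x i < 1\<close> and \<open>q (t i) \<le> 0\<close> if
  \<open>x i > 0\<close>. A type with \<open>x > 0\<close> between two types with \<open>x < 1\<close> is then impossible: if \<open>q\<close> is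
  strictly concave this is immediate; if \<open>q\<close> is strictly convex, then \<open>\<alpha> \<ge> 1/2\<close> ensures that \<open>q\<close>
  changes sign at most once on the positive axis; and otherwise \<open>q\<close> vanishes identically and
  \<open>\<alpha> = 1/2\<close>, where a direction of second-order descent exists. Two fractional types are
  impossible because moving them with the first moment fixed changes the cost by a quadratic
  with negative leading coefficient.
\<close>

section \<open>Delay of a single queue and one-sided minima\<close>

text \<open>Mean wait in a queue of capacity \<open>c\<close>, weighted by its arrival rate
  \<open>a\<close>; the load \<open>b\<close> and the second-moment term \<open>q\<close> are
  measured at unit capacity. Division by the total arrival rate is left out, as it does not move
  minimisers.\<close>

definition delay :: "real \<Rightarrow> real \<Rightarrow> real \<Rightarrow> real \<Rightarrow> real" where
  "delay c a b q = a * q / (c * (c - b))"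

lemma has_real_derivative_delay_line:
  assumes "c \<noteq> 0" "b \<noteq> c"
  shows "((\<lambda>e. delay c (a + e * a') (b + e * b') (q + e * q')) has_real_derivative
      (a' * q + a * q') / (c * (c - b)) + c * a * q * b' / (c * (c - b))\<^sup>2) (at 0)"
proof -
  have "((\<lambda>e. (a + e * a') * (q + e * q')) has_real_derivative (a' * q + a * q')) (at 0)"
    "((\<lambda>e. c * (c - (b + e * b'))) has_real_derivative (- (c * b'))) (at 0)"
    by (auto intro!: derivative_eq_intros)
  from DERIV_divide[OF this]
  have "((\<lambda>e. delay c (a + e * a') (b + e * b') (q + e * q')) has_real_derivative
      ((a' * q + a * q') * (c * (c - b)) - a * q * - (c * b')) / (c * (c - b) * (c * (c - b)))) (at 0)"
    using assms by (simp add: delay_def)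
  moreover have "((a' * q + a * q') * w - a * q * - (c * b')) / (w * w) =
      (a' * q + a * q') / w + c * a * q * b' / w\<^sup>2" if "w \<noteq> 0" for w
    using that by (simp add: field_simps power2_eq_square)
  ultimately show ?thesis using assms by simp
qed

text \<open>A type with \<open>x i\<close> equal to 0 or 1 can be moved one way only, so optimality
  yields just a one-sided minimum.\<close>

lemma right_min_deriv_nonneg:
  fixes f :: "real \<Rightarrow> real"
  assumes "(f has_real_derivative D) (at 0)" "\<forall>\<^sub>F e in at_right 0. f 0 \<le> f e"
  shows "0 \<le> D"
proof (rule ccontr)
  assume "\<not> 0 \<le> D"
  then obtain d where d: "d > 0" "\<And>h. h > 0 \<Longrightarrow> h < d \<Longrightarrow> f (0 + h) < f 0"
    using DERIV_neg_dec_right[OF assms(1)] by auto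
  have "\<forall>\<^sub>F e in at_right 0. e < d"
    using d(1) by (auto simp: eventually_at_right)
  with assms(2) have "\<forall>\<^sub>F e in at_right (0::real). False"
    using eventually_at_right_less[of "0 :: real"]
    by eventually_elim (use d in force)
  then show False by simp
qed

lemma eventually_shift_in_unit:
  fixes z r c :: real
  assumes "z \<in> {0..1}" "r \<le> 0 \<or> z < 1" "r \<ge> 0 \<or> z > 0" "c > 0"
  shows "\<forall>\<^sub>F e in at_right 0. z + e * r / c \<in> {0..1}"
proof -
  have lim: "((\<lambda>e. z + e * r / c) \<longlongrightarrow> z) (at_right 0)"
    by (auto intro!: tendsto_eq_intros simp: assms(4) less_imp_neq[symmetric])
  have pos: "\<forall>\<^sub>F e in at_right (0::real). 0 < e"
    by (rule eventually_at_right_less)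
  consider "r = 0" | "r > 0" | "r < 0" by linarith
  then show ?thesis
  proof cases
    case 1
    with assms(1) show ?thesis by simp
  next
    case 2
    then have "z < 1" using assms(2) by simp
    from order_tendstoD(2)[OF lim this] pos show ?thesis
      by eventually_elim (use 2 assms in auto)
  next
    case 3
    then have "z > 0" using assms(3) by simp
    from order_tendstoD(1)[OF lim this] pos show ?thesis
    proof eventually_elim
      case (elim e)
      then have "e * r / c \<le> 0"
        using 3 assms(4) by (simp add: mult_nonneg_nonpos divide_nonpos_pos)
      with elim assms(1) show ?case by simp
    qed
  qed
qed

section \<open>From the gap condition to the block pattern\<close>

text \<open>Take for \<open>l\<close> and \<open>h\<close> the least and greatest index with
  \<open>x < 1\<close>: beyond them all values are 1, and between them \<open>gap\<close>, applied
  to this pair, forces 0.\<close>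

lemma two_block_pattern:
  fixes x :: "nat \<Rightarrow> real"
  assumes "n \<ge> 1" and box: "\<And>i. i \<in> {1..n} \<Longrightarrow> x i \<in> {0..1}"
    and gap: "\<And>i j k. \<lbrakk>i \<in> {1..n}; k \<in> {1..n}; i < j; j < k; x i < 1; x k < 1\<rbrakk> \<Longrightarrow> x j \<le> 0"
  shows "\<exists>l h. l < h \<and> h \<le> n \<and> (\<forall>i\<in>{1..n}. i > h \<or> i < l \<longrightarrow> x i = 1) \<and>
      (\<forall>i\<in>{1..n}. l < i \<and> i < h \<longrightarrow> x i = 0)"
proof (cases "{i\<in>{1..n}. x i < 1} = {}")
  case True
  then have "x i = 1" if "i \<in> {1..n}" for i
    using box[OF that] that by force
  \<comment> \<open>The value 0 for \<open>l\<close> lies outside the range of types, and no index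
    is strictly between 0 and 1.\<close>
  with \<open>n \<ge> 1\<close> show ?thesis by (intro exI[of _ 0] exI[of _ 1]) auto
next
  case False
  let ?S = "{i\<in>{1..n}. x i < 1}"
  have fin: "finite ?S" by simp
  define m where "m = Min ?S"
  define h where "h = Max ?S"
  have mS: "m \<in> ?S" and hS: "h \<in> ?S"
    unfolding m_def h_def using fin False Min_in Max_in by blast+
  have bd: "m \<le> i \<and> i \<le> h" if "i \<in> ?S" for i
    unfolding m_def h_def using fin that by simp
  have one: "x i = 1" if "i \<in> {1..n}" "i < m \<or> h < i" for i
    using box[OF that(1)] bd[of i] that by force
  have zero: "x i = 0" if "i \<in> {1..n}" "m < i" "i < h" for i
    using gap[of m h i] box[OF that(1)] mS hS that by force
  show ?thesis
  proof (cases "m = h")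
    case True
    moreover have "0 < h" using hS by simp
    \<comment> \<open>With a single index below 1, \<open>h - 1\<close> (possibly 0) serves as
      \<open>l\<close> to meet \<open>l < h\<close>; nothing lies strictly between.\<close>
    ultimately have "h - 1 < h" "h \<le> n" "\<forall>i\<in>{1..n}. i > h \<or> i < h - 1 \<longrightarrow> x i = 1"
      "\<forall>i\<in>{1..n}. h - 1 < i \<and> i < h \<longrightarrow> x i = 0"
      using hS by (auto simp: True intro!: one)
    then show ?thesis by blast
  next
    case False
    with bd[OF hS] hS one zero show ?thesis by (intro exI[of _ m] exI[of _ h]) auto
  qed
qed

section \<open>The optimum in terms of moments\<close>

text \<open>The value \<open>\<alpha> = 1\<close> is excluded, so that both queues have positive
  capacity.\<close>

locale qap_optimum =
  fixes n :: nat and lam mu x :: "nat \<Rightarrow> real" and \<alpha> :: real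
  assumes n_pos: "n \<ge> 1"
    and lam_pos: "i \<in> {1..n} \<Longrightarrow> lam i > 0"
    and mu_pos: "i \<in> {1..n} \<Longrightarrow> mu i > 0"
    and mu_decr: "\<lbrakk>i \<in> {1..n}; j \<in> {1..n}; i < j\<rbrakk> \<Longrightarrow> mu i > mu j"
    and \<alpha>_ge: "1 / 2 \<le> \<alpha>" and \<alpha>_less: "\<alpha> < 1"
    and opt: "qap_optimal n lam mu \<alpha> x"
begin

definition t :: "nat \<Rightarrow> real" where "t i = 1 / mu i"

definition moment :: "nat \<Rightarrow> (nat \<Rightarrow> real) \<Rightarrow> real" where
  "moment k y = (\<Sum>i=1..n. lam i * y i * t i ^ k)"

definition cost :: "real \<Rightarrow> real \<Rightarrow> real \<Rightarrow> real" where
  "cost a b q = delay \<alpha> a b q +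
     delay (1 - \<alpha>) (moment 0 (\<lambda>_. 1) - a) (moment 1 (\<lambda>_. 1) - b) (moment 2 (\<lambda>_. 1) - q)"

lemma t_pos: "i \<in> {1..n} \<Longrightarrow> t i > 0"
  by (simp add: t_def mu_pos)

lemma t_less: "\<lbrakk>i \<in> {1..n}; j \<in> {1..n}; i < j\<rbrakk> \<Longrightarrow> t i < t j"
  using mu_decr mu_pos by (simp add: t_def frac_less2)

lemma moment_compl: "moment k (\<lambda>i. 1 - y i) = moment k (\<lambda>_. 1) - moment k y"
  by (simp add: moment_def sum_subtractf algebra_simps)

lemma moment_total_pos: "moment k (\<lambda>_. 1) > 0"
  unfolding moment_def using n_pos by (intro sum_pos) (auto simp: lam_pos t_pos)

lemma waiting_time_eq:
  "waiting_time n lam mu y \<alpha> = cost (moment 0 y) (moment 1 y) (moment 2 y) / moment 0 (\<lambda>_. 1)"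
proof -
  have *: "(\<Sum>i=1..n. z i * lam i) = moment 0 z" "(\<Sum>i=1..n. lam i * z i / mu i) = moment 1 z"
    "(\<Sum>i=1..n. lam i * z i / (mu i)\<^sup>2) = moment 2 z" "(\<Sum>i=1..n. lam i) = moment 0 (\<lambda>_. 1)"
    for z by (simp_all add: moment_def t_def mult.commute power_divide)
  have square: "z\<^sup>2 - z * w = z * (z - w)" for z w :: real
    by (simp add: power2_eq_square right_diff_distrib)
  show ?thesis
    unfolding waiting_time_def * moment_compl cost_def delay_def square
    using \<alpha>_ge \<alpha>_less by (simp add: add_divide_distrib mult.commute)
qed

lemma feasible_iff:
  "y \<in> qap_feasible n lam mu \<alpha> \<longleftrightarrow> moment 1 y < \<alpha> \<and> moment 1 (\<lambda>_. 1) - moment 1 y < 1 - \<alpha> \<and>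
     (\<forall>i\<in>{1..n}. y i \<in> {0..1})"
  using \<alpha>_ge \<alpha>_less by (auto simp: qap_feasible_def stable_set_def moment_def t_def)

text \<open>Arrival rate, load and second-moment term of the first queue at the optimum; primes mark
  the second queue.\<close>

definition A where "A = moment 0 x"
definition B where "B = moment 1 x"
definition C where "C = moment 2 x"
definition A' where "A' = moment 0 (\<lambda>_. 1) - A"
definition B' where "B' = moment 1 (\<lambda>_. 1) - B"
definition C' where "C' = moment 2 (\<lambda>_. 1) - C"

lemmas ABC_defs = A_def B_def C_def A'_def B'_def C'_def

lemma box: "i \<in> {1..n} \<Longrightarrow> x i \<in> {0..1}"
  and stable: "B < \<alpha>" "B' < 1 - \<alpha>"
  using opt by (auto simp: qap_optimal_def feasible_iff ABC_defs)

lemma cost_min: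
  assumes "y \<in> qap_feasible n lam mu \<alpha>"
  shows "cost A B C \<le> cost (moment 0 y) (moment 1 y) (moment 2 y)"
  using opt assms moment_total_pos[of 0]
  by (auto simp: qap_optimal_def waiting_time_eq divide_le_cancel ABC_defs)

section \<open>Perturbing two types\<close>

text \<open>Scaling the shifts by \<open>1 / lam i\<close> and \<open>1 / lam j\<close> makes the
  change of every moment independent of the arrival rates.\<close>

lemma moment_add_two:
  assumes "i \<in> {1..n}" "j \<in> {1..n}"
  shows "moment k (\<lambda>m. x m + (if m = i then r / lam i else 0) + (if m = j then s / lam j else 0))
    = moment k x + (r * t i ^ k + s * t j ^ k)"
proof -
  have "moment k (\<lambda>m. x m + (if m = i then r / lam i else 0) + (if m = j then s / lam j else 0))
    = (\<Sum>m=1..n. lam m * x m * t m ^ k + (if m = i then r * t i ^ k else 0)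
        + (if m = j then s * t j ^ k else 0))"
    unfolding moment_def
  proof (rule sum.cong)
    fix m assume "m \<in> {1..n}"
    then show "lam m * (x m + (if m = i then r / lam i else 0) + (if m = j then s / lam j else 0)) * t m ^ k
      = lam m * x m * t m ^ k + (if m = i then r * t i ^ k else 0) + (if m = j then s * t j ^ k else 0)"
      using lam_pos[of m] by (auto simp: field_simps)
  qed simp
  then show ?thesis using assms by (simp add: sum.distrib moment_def)
qed

text \<open>Stability is strict and survives small moves; the sign conditions keep both types in the
  unit interval. The stability bounds are returned as well because \<open>not_stationary\<close>
  needs positive denominators along the move.\<close>

lemma eventually_cost_min:
  assumes ij: "i \<in> {1..n}" "j \<in> {1..n}" "i \<noteq> j"
    and sgn: "r \<le> 0 \<or> x i < 1" "r \<ge> 0 \<or> x i > 0" "s \<le> 0 \<or> x j < 1" "s \<ge> 0 \<or> x j > 0"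
  shows "\<forall>\<^sub>F e in at_right 0. B + e * (r * t i + s * t j) < \<alpha> \<and>
      B' - e * (r * t i + s * t j) < 1 - \<alpha> \<and>
      cost A B C \<le> cost (A + e * (r + s)) (B + e * (r * t i + s * t j))
        (C + e * (r * (t i)\<^sup>2 + s * (t j)\<^sup>2))"
proof -
  have *: "((\<lambda>e. B + e * (r * t i + s * t j)) \<longlongrightarrow> B) (at_right 0)"
    "((\<lambda>e. B' - e * (r * t i + s * t j)) \<longlongrightarrow> B') (at_right 0)"
    by (auto intro!: tendsto_eq_intros)
  have "\<forall>\<^sub>F e in at_right 0. x i + e * r / lam i \<in> {0..1}"
    "\<forall>\<^sub>F e in at_right 0. x j + e * s / lam j \<in> {0..1}"
    using eventually_shift_in_unit[OF box[OF ij(1)] sgn(1,2) lam_pos[OF ij(1)]]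
      eventually_shift_in_unit[OF box[OF ij(2)] sgn(3,4) lam_pos[OF ij(2)]] by auto
  with order_tendstoD(2)[OF *(1) stable(1)] order_tendstoD(2)[OF *(2) stable(2)]
  show ?thesis
  proof eventually_elim
    case (elim e)
    let ?y = "\<lambda>m. x m + (if m = i then e * r / lam i else 0) + (if m = j then e * s / lam j else 0)"
    have m: "moment 0 ?y = A + e * (r + s)" "moment 1 ?y = B + e * (r * t i + s * t j)"
      "moment 2 ?y = C + e * (r * (t i)\<^sup>2 + s * (t j)\<^sup>2)"
      unfolding moment_add_two[OF ij(1,2)] ABC_defs by (simp_all add: algebra_simps)
    have "?y \<in> qap_feasible n lam mu \<alpha>"
      unfolding feasible_iff m using elim box ij by (auto simp: B'_def)
    from cost_min[OF this] elim show ?case unfolding m by simp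
  qed
qed

section \<open>First-order conditions\<close>

definition u where "u = 1 / (\<alpha> * (\<alpha> - B))"
definition v where "v = 1 / ((1 - \<alpha>) * (1 - \<alpha> - B'))"

lemma uv_pos: "u > 0" "v > 0"
  using stable \<alpha>_ge \<alpha>_less by (auto simp: u_def v_def)

text \<open>Partial derivatives of \<open>cost\<close> at the optimum in the zeroth, first and
  second moment, hence the coefficients of the quadratic \<open>q\<close>.\<close>

definition p0 where "p0 = u * C - v * C'"
definition p1 where "p1 = \<alpha> * (u * A) * (u * C) - (1 - \<alpha>) * (v * A') * (v * C')"
definition p2 where "p2 = u * A - v * A'"

lemma cost_line_deriv:
  "((\<lambda>e. cost (A + e * a) (B + e * b) (C + e * c)) has_real_derivative
     p0 * a + p1 * b + p2 * c) (at 0)"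
proof -
  have "((\<lambda>e. delay \<alpha> (A + e * a) (B + e * b) (C + e * c) +
      delay (1 - \<alpha>) (A' + e * (-a)) (B' + e * (-b)) (C' + e * (-c))) has_real_derivative
     ((a * C + A * c) / (\<alpha> * (\<alpha> - B)) + \<alpha> * A * C * b / (\<alpha> * (\<alpha> - B))\<^sup>2) +
     (((-a) * C' + A' * (-c)) / ((1-\<alpha>) * (1-\<alpha> - B')) + (1-\<alpha>) * A' * C' * (-b) / ((1-\<alpha>) * (1-\<alpha> - B'))\<^sup>2))
     (at 0)"
    using stable \<alpha>_ge \<alpha>_less by (intro DERIV_add has_real_derivative_delay_line) auto
  also have "(\<lambda>e. delay \<alpha> (A + e * a) (B + e * b) (C + e * c) +
      delay (1 - \<alpha>) (A' + e * (-a)) (B' + e * (-b)) (C' + e * (-c)))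
    = (\<lambda>e. cost (A + e * a) (B + e * b) (C + e * c))"
    by (simp add: cost_def A'_def B'_def C'_def algebra_simps)
  also have "((a * C + A * c) / (\<alpha> * (\<alpha> - B)) + \<alpha> * A * C * b / (\<alpha> * (\<alpha> - B))\<^sup>2) +
     (((-a) * C' + A' * (-c)) / ((1-\<alpha>) * (1-\<alpha> - B')) + (1-\<alpha>) * A' * C' * (-b) / ((1-\<alpha>) * (1-\<alpha> - B'))\<^sup>2)
    = ((a * C + A * c) * u + \<alpha> * A * C * b * u\<^sup>2) +
     (((-a) * C' + A' * (-c)) * v + (1-\<alpha>) * A' * C' * (-b) * v\<^sup>2)"
    by (simp add: u_def v_def power_divide)
  also have "\<dots> = p0 * a + p1 * b + p2 * c"
    by (simp add: p0_def p1_def p2_def algebra_simps power2_eq_square)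
  finally show ?thesis .
qed

text \<open>This is the two-type move with second weight 0; \<open>n \<ge> 2\<close> supplies the
  type that stays put.\<close>

lemma grad_directional:
  assumes "i \<in> {1..n}" "r \<le> 0 \<or> x i < 1" "r \<ge> 0 \<or> x i > 0" "n \<ge> 2"
  shows "0 \<le> r * (p0 + p1 * t i + p2 * (t i)\<^sup>2)"
proof -
  obtain j where j: "j \<in> {1..n}" "i \<noteq> j"
    using \<open>n \<ge> 2\<close> by (cases "i = 1") (auto intro: that[of 1] that[of 2])
  have "\<forall>\<^sub>F e in at_right 0. cost A B C \<le> cost (A + e * r) (B + e * (r * t i)) (C + e * (r * (t i)\<^sup>2))"
    using eventually_cost_min[OF assms(1) j assms(2,3), of 0] by (simp add: eventually_conj_iff)
  from right_min_deriv_nonneg[OF cost_line_deriv] this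
  have "0 \<le> p0 * r + p1 * (r * t i) + p2 * (r * (t i)\<^sup>2)" by simp
  then show ?thesis by (simp add: algebra_simps)
qed

section \<open>Uniqueness of the fractional type\<close>

text \<open>The weights \<open>t j\<close> and \<open>- t i\<close> fix the first moment, hence both
  denominators, while the zeroth moment rises and the second falls. Both types being fractional, the
  move and its reverse are feasible for small steps.\<close>

lemma frac_unique:
  assumes ij: "i \<in> {1..n}" "j \<in> {1..n}" "i < j"
    and fr: "0 < x i" "x i < 1" "0 < x j" "x j < 1"
  shows False
proof -
  let ?a = "t j - t i" and ?c = "t i * t j * (t i - t j)"
  have ac: "?a > 0" "?c < 0"
    using t_less[OF ij] t_pos[OF ij(1)] t_pos[OF ij(2)] by (simp_all add: mult_pos_neg)
  have z: "t j * t i + - t i * t j = 0" "t j + - t i = ?a" "t j * (t i)\<^sup>2 + - t i * (t j)\<^sup>2 = ?c"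
    "- t j * t i + t i * t j = 0" "- t j + t i = - ?a" "- t j * (t i)\<^sup>2 + t i * (t j)\<^sup>2 = - ?c"
    by (simp_all add: algebra_simps power2_eq_square)
  have "\<forall>\<^sub>F e in at_right 0. cost A B C \<le> cost (A + e * ?a) B (C + e * ?c)"
    "\<forall>\<^sub>F e in at_right 0. cost A B C \<le> cost (A + e * (- ?a)) B (C + e * (- ?c))"
    using eventually_cost_min[of i j "t j" "- t i", unfolded z]
      eventually_cost_min[of i j "- t j" "t i", unfolded z] ij fr
    by (simp_all add: eventually_conj_iff)
  then have "\<forall>\<^sub>F e in at_right (0::real). False"
    using eventually_at_right_less[of "0 :: real"]
  proof eventually_elim
    case (elim e)
    have cost_B: "cost a B c = u * (a * c) + v * ((A' + A - a) * (C' + C - c))" for a c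
      by (simp add: cost_def delay_def u_def v_def A'_def B'_def C'_def)
    \<comment> \<open>The second difference cancels the linear terms and leaves a positive multiple
      of \<open>?a * ?c\<close>.\<close>
    have "0 \<le> cost (A + e * ?a) B (C + e * ?c) + cost (A + e * (- ?a)) B (C + e * (- ?c)) - 2 * cost A B C"
      using elim by simp
    also have "\<dots> = 2 * (u + v) * e\<^sup>2 * (?a * ?c)"
      unfolding cost_B by (simp add: algebra_simps power2_eq_square)
    also have "\<dots> < 0"
      using mult_pos_neg[OF ac] uv_pos elim by (intro mult_pos_neg[of "2 * (u + v) * e\<^sup>2"]) simp_all
    finally show ?case by simp
  qed
  then show False by simp
qed

section \<open>The degenerate case of a vanishing gradient\<close>

text \<open>Stationarity makes \<open>(A, C)\<close> and \<open>(A', C')\<close> the same multiples of \<open>\<alpha> - B\<close> and \<open>\<alpha> - B'\<close>.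
  Dividing each numerator by its denominator then leaves linear terms that cancel between the
  queues, and the remainders.\<close>

lemma cost_line_stationary:
  assumes half: "\<alpha> = 1 / 2" and stat: "u * A = v * A'" "u * C = v * C'"
    and "B + b < \<alpha>" "B' - b < 1 - \<alpha>"
  shows "cost (A + a) (B + b) (C + c) - cost A B C =
      (a + \<alpha> * (u * A) * b) * (c + \<alpha> * (u * C) * b) *
      (1 / (\<alpha> * (\<alpha> - B - b)) + 1 / (\<alpha> * (\<alpha> - B' + b)))"
proof -
  define P where "P = u * A"
  define R where "R = u * C"
  let ?a = "a + \<alpha> * P * b" and ?c = "c + \<alpha> * R * b"
  have \<beta>: "1 - \<alpha> = \<alpha>" using half by simp
  have \<alpha>: "\<alpha> > 0" using half by simp
  have pos: "\<alpha> - B > 0" "\<alpha> - B' > 0" "\<alpha> - B - b > 0" "\<alpha> - B' + b > 0"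
    using stable assms(4,5) \<beta> by auto
  have AC: "A = \<alpha> * P * (\<alpha> - B)" "C = \<alpha> * R * (\<alpha> - B)"
    using pos \<alpha> by (simp_all add: P_def R_def u_def)
  have AC': "A' = \<alpha> * P * (\<alpha> - B')" "C' = \<alpha> * R * (\<alpha> - B')"
    using pos \<alpha> \<beta> unfolding P_def R_def stat by (simp_all add: v_def[unfolded \<beta>])
  have key: "(\<alpha> * P * w + a0) * (\<alpha> * R * w + c0) / (\<alpha> * w)
      = \<alpha> * P * R * w + (P * c0 + R * a0) + a0 * c0 * (1 / (\<alpha> * w))"
    if "w > 0" for w a0 c0
    using that \<alpha> by (simp add: field_simps)
  have shifted: "A + a = \<alpha> * P * (\<alpha> - B - b) + ?a" "C + c = \<alpha> * R * (\<alpha> - B - b) + ?c"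
    "A' - a = \<alpha> * P * (\<alpha> - B' + b) + (- ?a)" "C' - c = \<alpha> * R * (\<alpha> - B' + b) + (- ?c)"
    by (simp_all add: AC AC' algebra_simps)
  have "cost (A + a) (B + b) (C + c) =
      (A + a) * (C + c) / (\<alpha> * (\<alpha> - B - b)) + (A' - a) * (C' - c) / (\<alpha> * (\<alpha> - B' + b))"
    unfolding cost_def delay_def \<beta> by (simp add: A'_def B'_def C'_def algebra_simps)
  also have "\<dots> = (\<alpha> * P * (\<alpha> - B - b) + ?a) * (\<alpha> * R * (\<alpha> - B - b) + ?c) / (\<alpha> * (\<alpha> - B - b)) +
      (\<alpha> * P * (\<alpha> - B' + b) + (- ?a)) * (\<alpha> * R * (\<alpha> - B' + b) + (- ?c)) / (\<alpha> * (\<alpha> - B' + b))"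
    by (simp only: shifted)
  also have "\<dots> = \<alpha> * P * R * (\<alpha> - B + (\<alpha> - B')) +
      ?a * ?c * (1 / (\<alpha> * (\<alpha> - B - b)) + 1 / (\<alpha> * (\<alpha> - B' + b)))"
    unfolding key[OF pos(3)] key[OF pos(4)] by (simp add: algebra_simps)
  finally have 1: "cost (A + a) (B + b) (C + c) = \<dots>" .
  have "cost A B C = A * C / (\<alpha> * (\<alpha> - B)) + A' * C' / (\<alpha> * (\<alpha> - B'))"
    unfolding cost_def delay_def \<beta> by (simp add: A'_def B'_def C'_def)
  also have "\<dots> = \<alpha> * P * R * (\<alpha> - B + (\<alpha> - B'))"
    using key[OF pos(1), of 0 0] key[OF pos(2), of 0 0]
    by (simp only: AC[symmetric] AC'[symmetric] add_0_right mult_zero_left mult_zero_right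
        distrib_left)
  finally show ?thesis using 1 by (simp add: P_def R_def)
qed

lemma moment_nonneg: "(\<And>i. i \<in> {1..n} \<Longrightarrow> y i \<ge> 0) \<Longrightarrow> moment k y \<ge> 0"
  unfolding moment_def by (intro sum_nonneg) (auto simp: lam_pos t_pos less_imp_le)

lemma moment_pos:
  assumes "j \<in> {1..n}" "x j > 0"
  shows "moment k x > 0"
  unfolding moment_def
  using assms box by (intro sum_pos2[of _ j]) (auto simp: lam_pos t_pos less_imp_le)

text \<open>The exact change in \<open>cost_line_stationary\<close> is a positive factor times a
  product of two linear forms in the weights \<open>(r, s)\<close> of the move. Their coefficients
  \<open>f\<close> and \<open>g\<close> are positive, so the product is negative somewhere with
  \<open>r > 0 > s\<close>, where raising \<open>i\<close> and lowering \<open>j\<close> is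
  admissible.\<close>

lemma not_stationary:
  assumes ij: "i \<in> {1..n}" "j \<in> {1..n}" "i \<noteq> j" "x i < 1" "x j > 0"
    and half: "\<alpha> = 1 / 2" and stat: "u * A = v * A'" "u * C = v * C'"
  shows False
proof -
  define P where "P = \<alpha> * (u * A)"
  define R where "R = \<alpha> * (u * C)"
  have nn: "P > 0" "R > 0"
    using half uv_pos moment_pos[OF ij(2,5)] by (auto simp: P_def R_def ABC_defs)
  define f where "f k = 1 + P * t k" for k
  define g where "g k = t k * (t k + R)" for k
  have t: "t i > 0" "t j > 0" "t i \<noteq> t j"
    using t_pos t_less ij by (auto simp: neq_iff dest!: t_less)
  have fg: "f i > 0" "f j > 0" "g i > 0" "g j > 0"
    using t nn by (auto simp: f_def g_def add_pos_pos)
  \<comment> \<open>Up to sign, the determinant of the two forms; if nonzero, they are not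
    proportional.\<close>
  have "g i * f j - g j * f i = (t i - t j) * (t i + t j + R + P * t i * t j)"
    by (simp add: f_def g_def algebra_simps)
  moreover have "t i + t j + R + P * t i * t j > 0" using t nn by (simp add: add_pos_pos)
  ultimately have ne: "g i * f j - g j * f i \<noteq> 0" using t by auto
  \<comment> \<open>\<open>s / r\<close> is midway between \<open>- f i / f j\<close> and \<open>- g i / g j\<close>, where the two factors of
    the second-order term vanish.\<close>
  define r where "r = 2 * f j * g j"
  define s where "s = - (f i * g j + g i * f j)"
  have rs: "r > 0" "s < 0"
    using mult_pos_pos[OF fg(2,4)] mult_pos_pos[OF fg(1,4)] mult_pos_pos[OF fg(3,2)]
    unfolding r_def s_def by linarith+
  have prod: "(r * f i + s * f j) * (r * g i + s * g j) = - (f j * g j * (g i * f j - g j * f i)\<^sup>2)"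
    by (simp add: r_def s_def algebra_simps power2_eq_square)
  then have neg: "(r * f i + s * f j) * (r * g i + s * g j) < 0"
    using fg ne by simp
  have "r \<le> 0 \<or> x i < 1" "r \<ge> 0 \<or> x i > 0" "s \<le> 0 \<or> x j < 1" "s \<ge> 0 \<or> x j > 0"
    using ij rs by auto
  from eventually_cost_min[OF ij(1-3) this]
  have "\<forall>\<^sub>F e in at_right (0::real). False"
    using eventually_at_right_less[of "0 :: real"]
  proof eventually_elim
    case (elim e)
    let ?a = "e * (r + s)" and ?b = "e * (r * t i + s * t j)" and ?c = "e * (r * (t i)\<^sup>2 + s * (t j)\<^sup>2)"
    let ?w = "1 / (\<alpha> * (\<alpha> - B - ?b)) + 1 / (\<alpha> * (\<alpha> - B' + ?b))"
    have w: "?w > 0" using elim half by (intro add_pos_pos) auto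
    have "0 \<le> (?a + P * ?b) * (?c + R * ?b) * ?w"
      using cost_line_stationary[OF half stat, of ?b ?a ?c] elim by (simp add: P_def R_def)
    also have "(?a + P * ?b) * (?c + R * ?b) = e\<^sup>2 * ((r * f i + s * f j) * (r * g i + s * g j))"
      by (simp add: f_def g_def algebra_simps power2_eq_square)
    also have "e\<^sup>2 * ((r * f i + s * f j) * (r * g i + s * g j)) * ?w < 0"
      using elim by (intro mult_neg_pos[OF mult_pos_neg[OF _ neg] w]) simp
    finally show ?case by simp
  qed
  then show False by simp
qed

section \<open>Sign pattern of the gradient quadratic\<close>

lemma no_gap:
  assumes ik: "i \<in> {1..n}" "k \<in> {1..n}" "i < j" "j < k" and lt: "x i < 1" "x k < 1"
  shows "x j \<le> 0"
proof (rule ccontr)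
  assume "\<not> x j \<le> 0"
  then have xj: "x j > 0" by simp
  have j: "j \<in> {1..n}" and n2: "n \<ge> 2" using ik by auto
  define q where "q z = p0 + p1 * z + p2 * z\<^sup>2" for z
  have q: "q (t i) \<ge> 0" "q (t k) \<ge> 0" "q (t j) \<le> 0"
    using grad_directional[of i 1] grad_directional[of k 1] grad_directional[of j "-1"] ik j n2 lt xj
    by (auto simp: q_def)
  have t: "0 < t i" "t i < t j" "t j < t k" using ik j t_pos t_less by auto
  have AC: "A > 0" "C > 0" using moment_pos[OF j xj] by (auto simp: ABC_defs)
  note uv = uv_pos
  \<comment> \<open>The second divided difference of a quadratic is its leading coefficient; here it
    is cleared of denominators.\<close>
  have interp: "(t k - t j) * q (t i) + (t j - t i) * q (t k) - (t k - t i) * q (t j)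
      = p2 * ((t k - t j) * (t j - t i) * (t k - t i))"
    by (simp add: q_def algebra_simps power2_eq_square)
  have lhs: "(t k - t j) * q (t i) \<ge> 0" "(t j - t i) * q (t k) \<ge> 0" "(t k - t i) * q (t j) \<le> 0"
    using q t by (auto simp: mult_nonneg_nonpos)
  have vol: "(t k - t j) * (t j - t i) * (t k - t i) > 0" using t by simp
  consider "p2 < 0" | "p2 = 0" | "p2 > 0" by linarith
  then show False
  proof cases
    case 1
    with vol interp lhs mult_neg_pos[OF 1 vol] show False by linarith
  next
    case 2
    \<comment> \<open>Three nonnegative terms sum to zero, so each vanishes; \<open>q\<close> is
      affine here and has two zeros, hence is identically zero.\<close>
    have "(t k - t j) * q (t i) + (t j - t i) * q (t k) - (t k - t i) * q (t j) = 0"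
      using interp 2 by simp
    with lhs have "(t k - t i) * q (t j) = 0" "(t j - t i) * q (t k) = 0" by linarith+
    then have "q (t j) = 0" "q (t k) = 0" using t by auto
    moreover have "p1 * (t k - t j) = q (t k) - q (t j)"
      using 2 by (simp add: q_def algebra_simps)
    ultimately have "p1 = 0" using t by simp
    with \<open>q (t j) = 0\<close> have p: "p1 = 0" "p0 = 0" using 2 by (simp_all add: q_def)
    have eq: "u * A = v * A'" "u * C = v * C'" using 2 p by (auto simp: p2_def p0_def)
    \<comment> \<open>Inserting both equalities into \<open>p1 = 0\<close> leaves
      \<open>2 * \<alpha> - 1\<close> times a positive number.\<close>
    have "(\<alpha> - (1 - \<alpha>)) * ((u * A) * (u * C)) = 0"
      using p(1) unfolding p1_def eq by (simp add: algebra_simps)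
    then have "\<alpha> = 1 / 2" using AC uv by auto
    from not_stationary[OF ik(1) j _ lt(1) xj this eq] ik show False by simp
  next
    case 3
    show False
    proof (cases "p0 > 0")
      case True
      \<comment> \<open>With \<open>p0\<close> and \<open>p2\<close> positive the first queue
        dominates in both factors of \<open>p1\<close>, and
        \<open>\<alpha> \<ge> 1 - \<alpha>\<close> then gives \<open>p1 \<ge> 0\<close>:
        \<open>q\<close> is positive on the positive axis.\<close>
      have nn: "v * A' \<ge> 0" "v * C' \<ge> 0"
        using uv moment_nonneg[of "\<lambda>i. 1 - x i"] box
        by (auto simp: ABC_defs moment_compl intro!: mult_nonneg_nonneg)
      have le: "v * A' \<le> u * A" "v * C' \<le> u * C" "1 - \<alpha> \<le> \<alpha>"
        using True 3 \<alpha>_ge by (simp_all add: p0_def p2_def)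
      have "0 \<le> u * A" "0 \<le> \<alpha>" using AC uv \<alpha>_ge by simp_all
      with mult_mono[OF le(3) mult_mono[OF le(1,2)]] nn
      have "(1 - \<alpha>) * ((v * A') * (v * C')) \<le> \<alpha> * ((u * A) * (u * C))" by simp
      then have "p1 \<ge> 0" by (simp add: p1_def mult.assoc)
      then have "q (t j) > 0" unfolding q_def using True 3 t by (intro add_pos_pos add_pos_nonneg) auto
      with q show False by simp
    next
      case False
      \<comment> \<open>For \<open>p0 \<le> 0 < p2\<close> the quotient \<open>q z / z\<close> is
        strictly increasing on the positive axis, so \<open>q\<close> cannot go from nonnegative at
        \<open>t i\<close> to nonpositive at \<open>t j\<close>.\<close>
      have "t i * q (t j) - t j * q (t i) = (t j - t i) * (p2 * t i * t j - p0)"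
        by (simp add: q_def algebra_simps power2_eq_square)
      moreover have "p2 * t i * t j > 0" using 3 t by simp
      then have "(t j - t i) * (p2 * t i * t j - p0) > 0" using t False by simp
      moreover have "t j * q (t i) \<ge> 0" "t i * q (t j) \<le> 0"
        using q t by (simp_all add: mult_nonneg_nonpos)
      ultimately show False by linarith
    qed
  qed
qed

lemma frac_set: "{i\<in>{1..n}. 0 < x i \<and> x i < 1} = {} \<or> is_singleton {i\<in>{1..n}. 0 < x i \<and> x i < 1}"
proof -
  have "i = j" if "i \<in> {1..n}" "j \<in> {1..n}" "0 < x i" "x i < 1" "0 < x j" "x j < 1" for i j
    using that frac_unique[of i j] frac_unique[of j i] by (cases i j rule: linorder_cases) simp_all
  then have "is_singleton {i\<in>{1..n}. 0 < x i \<and> x i < 1}" if "{i\<in>{1..n}. 0 < x i \<and> x i < 1} \<noteq> {}"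
    by (intro is_singletonI' that) simp
  then show ?thesis by argo
qed

end

theorem theorem2:
  fixes n :: nat and lam mu x :: "nat \<Rightarrow> real" and \<alpha> :: real
  assumes "n \<ge> 1"
    and "\<And>i. i \<in> {1..n} \<Longrightarrow> lam i > 0"
    and "\<And>i. i \<in> {1..n} \<Longrightarrow> mu i > 0"
    and "\<And>i j. i \<in> {1..n} \<Longrightarrow> j \<in> {1..n} \<Longrightarrow> i < j \<Longrightarrow> mu i > mu j"
    and "\<alpha> \<in> {1/2..1}"
    and "qap_optimal n lam mu \<alpha> x"
  shows "\<exists>l h :: nat. l < h \<and> h \<le> n \<and>
      (\<forall>i\<in>{1..n}. i > h \<or> i < l \<longrightarrow> x i = 1) \<and>
      (\<forall>i\<in>{1..n}. l < i \<and> i < h \<longrightarrow> x i = 0) \<and>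
      (\<forall>i\<in>{1..n}. i \<in> {l, h} \<longrightarrow> x i \<in> {0..1}) \<and>
      ({i\<in>{1..n}. 0 < x i \<and> x i < 1} = {} \<or> is_singleton {i\<in>{1..n}. 0 < x i \<and> x i < 1})"
proof (cases "\<alpha> = 1")
  case True
  then have "\<forall>i\<in>{1..n}. x i = 1"
    using assms(6) by (auto simp: qap_optimal_def qap_feasible_def stable_set_def)
  with assms(1) show ?thesis by (intro exI[of _ 0] exI[of _ 1]) auto
next
  case False
  then have \<alpha>: "1 / 2 \<le> \<alpha>" "\<alpha> < 1" using assms(5) by auto
  interpret qap_optimum n lam mu x \<alpha>
    by (rule qap_optimum.intro) (fact assms \<alpha>)+
  have "\<exists>l h. l < h \<and> h \<le> n \<and> (\<forall>i\<in>{1..n}. i > h \<or> i < l \<longrightarrow> x i = 1) \<and>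
      (\<forall>i\<in>{1..n}. l < i \<and> i < h \<longrightarrow> x i = 0)"
    by (rule two_block_pattern[OF n_pos box no_gap])
  then obtain l h where "l < h" "h \<le> n" "\<forall>i\<in>{1..n}. i > h \<or> i < l \<longrightarrow> x i = 1"
    "\<forall>i\<in>{1..n}. l < i \<and> i < h \<longrightarrow> x i = 0"
    by (elim exE conjE)
  moreover have "\<forall>i\<in>{1..n}. i \<in> {l, h} \<longrightarrow> x i \<in> {0..1}" using box by blast
  ultimately show ?thesis
    using frac_set by (intro exI[of _ l] exI[of _ h] conjI)
qed

end
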